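(* Let $\alpha(x)=\alpha_0+\alpha_1x+\alpha_2x^2$ with $\alpha_i\in\mathbb{C}$, $\alpha\ne0$, and let $\Psi(x)=\psi_0+\psi_1x$ with $\psi_0,\psi_1\in\mathbb{C}^{(m,m)}$. Put $N_n=\psi_0+n\alpha_1I$ and $M_n=\psi_1+n\alpha_2I$. The Pearson-type equation $D(u\alpha I)=u\Psi$ has a quasi-definite solution $u\in\mathbb{P}^{(m)'}$ if and only if $M_n$ and $\alpha(-N_nM_{2n}^{-1})$ are non-singular for all $n\ge0$. Under these conditions, the solution of the Pearson-type equation is unique up to left matrix factors, and the quasi-definite solutions correspond to the non-singular choices of $\mu_0=\langle I,u\rangle$.
   Context: Fix $m\ge 1$. $\mathbb{C}^{(m,m)}$ is the set of $m\times m$ complex matrices and $I$ the identity matrix. $\mathbb{P}^{(m)}$ is the left $\mathbb{C}^{(m,m)}$-module of polynomials in $x$ with coefficients in $\mathbb{C}^{(m,m)}$. $\mathbb{P}^{(m)'}$ is the set of left-$\mathbb{C}^{(m,m)}$-linear maps $u:\mathbb{P}^{(m)}\to\mathbb{C}^{(m,m)}$, and $\langle P,u\rangle=u(P)$. For $Q(x)=\sum_k q_kx^k\in\mathbb{P}^{(m)}$, the functional $uQ$ is defined by $\langle P,uQ\rangle=\sum_k\langle x^kP,u\rangle q_k$; for $A\in\mathbb{C}^{(m,m)}$ the left product $Au$ is defined by $\langle P,Au\rangle=\langle PA,u\rangle$ (so its moments are $A\mu_n$). The derivative $Du$ is defined by $\langle P,Du\rangle=-\langle P',u\rangle$. The moments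 of $u$ are $\mu_n=\langle x^nI,u\rangle$, $\Delta_n=(\mu_{i+j})_{i,j=0}^n$ is the block Hankel matrix, and $u$ is quasi-definite if $\det\Delta_n\ne0$ for all $n\ge0$. For a square matrix $A$, $\alpha(A)=\alpha_0I+\alpha_1A+\alpha_2A^2$. "Unique up to left matrix factors" means that each solution is determined by $\mu_0$, and every $\mu_0\in\mathbb{C}^{(m,m)}$ occurs: the solutions are exactly $\mu_0 u_1$, where $u_1$ is the solution with $\langle I,u_1\rangle=I$. *)

theory Defs
  imports "HOL-Analysis.Analysis" "Jordan_Normal_Form.Determinant"
begin

(* "mat", "det" and "$" refer to the matrices of HOL-Analysis from here on. *)
hide_const (open) Matrix.mat Determinant.det
no_notation Matrix.vec_index (infixl "$" 100)

type_synonym 'm cmat = "complex^'m^'m"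

text \<open>
  On \<^typ>\<open>complex^'m^'m\<close> the class operation \<^const>\<open>times\<close> acts componentwise, so the products and
  the derivative of the polynomial library are not the matrix ones.  Only the additive structure
  of \<^typ>\<open>'m cmat poly\<close> is taken from there, and multiplication by \<open>x\<close> is \<^term>\<open>pCons 0\<close>.
  Multiplication of a matrix by a scalar \<open>c\<close> is multiplication by \<^term>\<open>mat c\<close>.
\<close>

definition lmult_poly :: "'m::finite cmat \<Rightarrow> 'm cmat poly \<Rightarrow> 'm cmat poly" where
  "lmult_poly A P = map_poly (\<lambda>C. A ** C) P"

definition rmult_poly :: "'m::finite cmat poly \<Rightarrow> 'm cmat \<Rightarrow> 'm cmat poly" where
  "rmult_poly P A = map_poly (\<lambda>C. C ** A) P"

definition xpow_mult :: "nat \<Rightarrow> 'm::finite cmat poly \<Rightarrow> 'm cmat poly" where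
  "xpow_mult k P = ((pCons 0) ^^ k) P"

definition deriv_poly :: "'m::finite cmat poly \<Rightarrow> 'm cmat poly" where
  "deriv_poly P = (\<Sum>k = 1..degree P. monom (mat (of_nat k) ** coeff P k) (k - 1))"

lemma coeff_lmult_poly: "coeff (lmult_poly A P) n = A ** coeff P n"
  by (simp add: lmult_poly_def coeff_map_poly)

lemma coeff_rmult_poly: "coeff (rmult_poly P A) n = coeff P n ** A"
  by (simp add: rmult_poly_def coeff_map_poly)

lemma coeff_deriv_poly: "coeff (deriv_poly P) n = mat (of_nat (Suc n)) ** coeff P (Suc n)"
proof -
  have "coeff (deriv_poly P) n =
      (\<Sum>k = 1..degree P. if k = Suc n then mat (of_nat k) ** coeff P k else 0)"
    unfolding deriv_poly_def coeff_sum by (rule sum.cong) auto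
  also have "\<dots> = mat (of_nat (Suc n)) ** coeff P (Suc n)"
    by (auto simp: sum.delta coeff_eq_0)
  finally show ?thesis .
qed

type_synonym 'm mfunctional = "'m cmat poly \<Rightarrow> 'm cmat"

definition left_linear :: "'m::finite mfunctional \<Rightarrow> bool" where
  "left_linear u \<longleftrightarrow>
     (\<forall>P Q. u (P + Q) = u P + u Q) \<and> (\<forall>A P. u (lmult_poly A P) = A ** u P)"

definition fun_mult_poly :: "'m::finite mfunctional \<Rightarrow> 'm cmat poly \<Rightarrow> 'm mfunctional" where
  "fun_mult_poly u Q = (\<lambda>P. \<Sum>k\<le>degree Q. u (xpow_mult k P) ** coeff Q k)"

definition lmult_fun :: "'m::finite cmat \<Rightarrow> 'm mfunctional \<Rightarrow> 'm mfunctional" where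
  "lmult_fun A u = (\<lambda>P. u (rmult_poly P A))"

definition deriv_fun :: "'m::finite mfunctional \<Rightarrow> 'm mfunctional" where
  "deriv_fun u = (\<lambda>P. - u (deriv_poly P))"

definition moment :: "'m::finite mfunctional \<Rightarrow> nat \<Rightarrow> 'm cmat" where
  "moment u n = u (monom (mat 1) n)"

text \<open>
  The block Hankel matrix has size \<open>(n + 1) * m\<close>, which depends on \<open>n\<close>, so it is a matrix of
  dynamic dimension.  Position \<open>p\<close> lies in block \<open>p div m\<close>, and \<open>p mod m\<close> is translated into an
  index of type \<^typ>\<open>'m\<close> by the library's enumeration of a finite type; the determinant does not
  depend on this choice, since rows and columns use the same enumeration.
\<close>

definition block_hankel :: "'m::finite mfunctional \<Rightarrow> nat \<Rightarrow> complex mat" where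
  "block_hankel u n =
     (let m = CARD('m); e = from_nat_into (UNIV :: 'm set)
      in Matrix.mat ((n + 1) * m) ((n + 1) * m)
           (\<lambda>(p, q). moment u (p div m + q div m) $ e (p mod m) $ e (q mod m)))"

lemma bij_betw_enumeration: "bij_betw (from_nat_into (UNIV :: 'm::finite set)) {..<CARD('m)} UNIV"
  by (rule bij_betw_from_nat_into_finite) simp

definition quasi_definite :: "'m::finite mfunctional \<Rightarrow> bool" where
  "quasi_definite u \<longleftrightarrow> (\<forall>n. Determinant.det (block_hankel u n) \<noteq> 0)"

definition quad_at :: "complex \<Rightarrow> complex \<Rightarrow> complex \<Rightarrow> 'm::finite cmat \<Rightarrow> 'm cmat" where
  "quad_at \<alpha>0 \<alpha>1 \<alpha>2 A = mat \<alpha>0 + mat \<alpha>1 ** A + mat \<alpha>2 ** (A ** A)"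

definition pearson_solution ::
  "complex \<Rightarrow> complex \<Rightarrow> complex \<Rightarrow> 'm::finite cmat \<Rightarrow> 'm cmat \<Rightarrow> 'm mfunctional \<Rightarrow> bool" where
  "pearson_solution \<alpha>0 \<alpha>1 \<alpha>2 \<psi>0 \<psi>1 u \<longleftrightarrow>
     left_linear u \<and>
     deriv_fun (fun_mult_poly u [:mat \<alpha>0, mat \<alpha>1, mat \<alpha>2:]) = fun_mult_poly u [:\<psi>0, \<psi>1:]"

end

theory Submission
  imports Defs
begin

text \<open>
  On moments, the Pearson equation is the recurrence
  \<open>\<mu>\<^sub>n\<^sub>+\<^sub>1 M\<^sub>n + \<mu>\<^sub>n N\<^sub>n + n \<alpha>\<^sub>0 \<mu>\<^sub>n\<^sub>-\<^sub>1 = 0\<close>, and quasi-definiteness says that the form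
  \<open>\<langle>x\<^sup>i, u r\<rangle> = \<Sum>\<^sub>k \<mu>\<^sub>i\<^sub>+\<^sub>k r\<^sub>k\<close> has no right kernel among the column polynomials \<open>r\<close> of degree
  at most \<open>n\<close>.  Put \<open>T r = \<alpha>r' + \<Psi>r\<close> and \<open>v = u\<alpha>\<close>.  The equation gives
  \<open>\<langle>x\<^sup>i, u (T r)\<rangle> = - i \<langle>x\<^sup>i\<^sup>-\<^sup>1, v r\<rangle>\<close>, and \<open>T\<close> is triangular: it sends \<open>w x\<^sup>k\<close> to
  \<open>M\<^sub>k w x\<^sup>k\<^sup>+\<^sup>1 + \<dots>\<close>.

  If \<open>u\<close> is a quasi-definite solution, \<open>M\<^sub>0, \<dots>, M\<^sub>n\<^sub>-\<^sub>1\<close> are non-singular and \<open>M\<^sub>n w = 0\<close>, one finds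
  \<open>r = w x\<^sup>n + \<dots>\<close> with \<open>T r\<close> constant; then \<open>T r = 0\<close>, so \<open>\<alpha> r\<close> lies in the kernel of \<open>u\<close> and \<open>w = 0\<close>.
  If all \<open>M\<^sub>n\<close> are non-singular, \<open>T\<close> is bijective modulo constants, so \<open>u\<close> is non-degenerate in
  degree \<open>n + 1\<close> iff \<open>v\<close> is so in degree \<open>n\<close>, provided \<open>\<mu>\<^sub>0\<close> is non-singular.
  Now \<open>v\<close> satisfies the equation with \<open>N\<^sub>n\<close>, \<open>M\<^sub>n\<close> replaced by \<open>N\<^sub>n\<^sub>+\<^sub>1\<close>, \<open>M\<^sub>n\<^sub>+\<^sub>2\<close>, and
  \<open>\<langle>I, v\<rangle> M\<^sub>0\<^sup>-\<^sup>1 M\<^sub>1 = \<mu>\<^sub>0 \<alpha>(- N\<^sub>0 M\<^sub>0\<^sup>-\<^sup>1)\<close>, so iterating \<open>u \<mapsto> u\<alpha>\<close> produces exactly the stated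
  conditions.
\<close>

text \<open>Unqualified, the fact names \<open>vec_eq_iff\<close> and \<open>mat_def\<close> are those of the Jordan normal form library.\<close>
lemmas cvec_eq_iff = Finite_Cartesian_Product.vec_eq_iff

section \<open>Scalar matrices and invertibility of complex matrices\<close>

lemma mat_mul_component: "(mat c ** (A :: 'm::finite cmat)) $ i $ j = c * A $ i $ j"
  by (simp add: matrix_matrix_mult_def Finite_Cartesian_Product.mat_def if_distrib [of "\<lambda>x. x * _"] sum.delta cong: if_cong)

lemma mul_mat_component: "((A :: 'm::finite cmat) ** mat c) $ i $ j = c * A $ i $ j"
  by (simp add: matrix_matrix_mult_def Finite_Cartesian_Product.mat_def if_distrib [of "\<lambda>x. _ * x"] sum.delta' mult.commute
      cong: if_cong)

lemma mat_mul_commute: "mat c ** A = (A :: 'm::finite cmat) ** mat c"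
  by (simp add: cvec_eq_iff mat_mul_component mul_mat_component)

lemma mat_vector_mult: "mat c *v (x :: complex^'m::finite) = c *s x"
  by (simp add: cvec_eq_iff matrix_vector_mult_def Finite_Cartesian_Product.mat_def if_distrib [of "\<lambda>x. x * _"] sum.delta
      cong: if_cong)

lemma matrix_vector_mult_minus: "A *v (- x) = - (A *v (x :: complex^'m::finite))"
  by (metis diff_0 matrix_vector_mult_0_right matrix_vector_mult_diff_distrib)

lemma invertible_matrix_inv:
  fixes A :: "'m::finite cmat"
  assumes "invertible A"
  shows "A ** matrix_inv A = mat 1" "matrix_inv A ** A = mat 1"
  using someI_ex [OF assms [unfolded invertible_def]] by (auto simp: matrix_inv_def)

lemma invertible_iff_kernel:
  fixes A :: "'m::finite cmat"
  shows "invertible A \<longleftrightarrow> (\<forall>x. A *v x = 0 \<longrightarrow> x = 0)"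
  by (metis invertible_left_inverse matrix_left_invertible_ker)

lemma invertible_mult_iff:
  fixes A B :: "'m::finite cmat"
  shows "invertible (A ** B) \<longleftrightarrow> invertible A \<and> invertible B"
  by (simp add: invertible_det_nz det_mul)

lemma matrix_add_rdistrib: "(A + B) ** C = A ** C + B ** (C :: 'm::finite cmat)"
  by (simp add: cvec_eq_iff matrix_matrix_mult_def sum.distrib distrib_right)

lemma matrix_mult_sum: "B ** (\<Sum>k\<in>I. f k) = (\<Sum>k\<in>I. (B :: 'm::finite cmat) ** f k)"
  by (induction I rule: infinite_finite_induct) (simp_all add: matrix_add_ldistrib)

lemma matrix_mult_minus: "A ** (- B) = - (A ** (B :: 'm::finite cmat))"
  by (simp add: cvec_eq_iff matrix_matrix_mult_def sum_negf)

lemma mat_mul_left_commute: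
  fixes A B :: "'m::finite cmat"
  shows "mat c ** (A ** B) = A ** (mat c ** B)"
  by (simp only: matrix_mul_assoc mat_mul_commute [of c A])

subsection \<open>Block Hankel matrices\<close>

text \<open>A column polynomial of degree at most \<open>n\<close> is a sequence vanishing beyond
  \<open>n\<close>; all degrees share one type, so operators may raise the degree freely.\<close>

definition nondegenerate :: "(nat \<Rightarrow> 'm::finite cmat) \<Rightarrow> nat \<Rightarrow> bool" where
  "nondegenerate \<mu> n \<longleftrightarrow>
     (\<forall>r. (\<forall>k>n. r k = 0) \<longrightarrow> (\<forall>i\<le>n. (\<Sum>k\<le>n. \<mu> (i + k) *v r k) = 0) \<longrightarrow> r = (\<lambda>_. 0))"

lemma nondegenerate_0: "nondegenerate \<mu> 0 \<longleftrightarrow> invertible (\<mu> 0)"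
proof
  assume nd: "nondegenerate \<mu> 0"
  show "invertible (\<mu> 0)"
    unfolding invertible_iff_kernel
  proof (intro allI impI)
    fix x assume "\<mu> 0 *v x = 0"
    then have "(\<lambda>k::nat. if k = 0 then x else 0) = (\<lambda>_. 0)"
      using nd [unfolded nondegenerate_def, rule_format, of "\<lambda>k. if k = 0 then x else 0"] by simp
    then show "x = 0" by (metis (full_types))
  qed
next
  assume "invertible (\<mu> 0)"
  then show "nondegenerate \<mu> 0"
    unfolding nondegenerate_def invertible_iff_kernel by (auto simp: fun_eq_iff) (metis gr0I)
qed

lemma sum_lessThan_mult:
  fixes f :: "nat \<Rightarrow> 'a::comm_monoid_add"
  shows "(\<Sum>q<n * m. f q) = (\<Sum>k<n. \<Sum>j<m. f (k * m + j))"
proof -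
  have "(\<Sum>q = k * m..<k * m + m. f q) = (\<Sum>j<m. f (k * m + j))" for k
    using sum.shift_bounds_nat_ivl [of f 0 "k * m" m] by (simp add: lessThan_atLeast0 add.commute)
  then show ?thesis
    by (simp flip: sum.nat_group)
qed

text \<open>Position \<open>k * m + j\<close> of the flattened vector holds component
  \<open>e j\<close> of \<open>r k\<close>. The row sum splits at multiples of \<open>m\<close>, and
  the enumeration \<open>e\<close> reindexes each block.\<close>

lemma block_hankel_mult_vec:
  fixes u :: "'m::finite mfunctional" and r :: "nat \<Rightarrow> complex^'m" and n :: nat
  defines "m \<equiv> CARD('m)" and "e \<equiv> from_nat_into (UNIV :: 'm set)"
  assumes p: "p < (n + 1) * m"
  shows "Matrix.vec_index (block_hankel u n *\<^sub>v Matrix.vec ((n + 1) * m) (\<lambda>q. r (q div m) $ e (q mod m))) p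
    = (\<Sum>k\<le>n. moment u (p div m + k) *v r k) $ e (p mod m)"
proof -
  define c where "c k s t = moment u (p div m + k) $ s $ t * r k $ t" for k s t
  have m: "m > 0" by (simp add: m_def)
  have "Matrix.vec_index (block_hankel u n *\<^sub>v Matrix.vec ((n + 1) * m) (\<lambda>q. r (q div m) $ e (q mod m))) p
      = (\<Sum>q<(n + 1) * m. c (q div m) (e (p mod m)) (e (q mod m)))"
    using p by (simp add: block_hankel_def Let_def scalar_prod_def c_def lessThan_atLeast0
        flip: m_def e_def)
  also have "\<dots> = (\<Sum>k<n + 1. \<Sum>j<m. c k (e (p mod m)) (e j))"
    unfolding sum_lessThan_mult using m by (intro sum.cong refl) simp
  also have "\<dots> = (\<Sum>k<n + 1. \<Sum>t\<in>UNIV. c k (e (p mod m)) t)"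
    unfolding m_def e_def by (intro sum.cong refl sum.reindex_bij_betw bij_betw_enumeration)
  also have "\<dots> = (\<Sum>k\<le>n. moment u (p div m + k) *v r k) $ e (p mod m)"
    by (simp add: c_def matrix_vector_mult_def lessThan_Suc_atMost)
  finally show ?thesis .
qed

text \<open>The determinant is zero iff the matrix has a nonzero kernel vector. Flattening is a
  bijection from sequences supported on 0..n to vectors of dimension \<open>(n + 1) * m\<close>, and
  it matches the two kernel conditions.\<close>

lemma det_block_hankel:
  fixes u :: "'m::finite mfunctional"
  shows "Determinant.det (block_hankel u n) \<noteq> 0 \<longleftrightarrow> nondegenerate (moment u) n"
proof -
  define m where "m = CARD('m)"
  define e where "e = from_nat_into (UNIV :: 'm set)"
  define d where "d = inv_into {..<m} e"
  define w :: "(nat \<Rightarrow> complex^'m) \<Rightarrow> complex Matrix.vec"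
    where "w r = Matrix.vec ((n + 1) * m) (\<lambda>q. r (q div m) $ e (q mod m))" for r
  have m: "m > 0" by (simp add: m_def)
  have bij: "bij_betw e {..<m} UNIV"
    unfolding m_def e_def by (rule bij_betw_enumeration)
  have ed: "e (d t) = t" and dm: "d t < m" for t
    using bij inv_into_into [of t e "{..<m}"] by (auto simp: d_def f_inv_into_f bij_betw_def)
  have de: "d (e j) = j" if "j < m" for j
    using bij that by (simp add: d_def bij_betw_def)
  have mv: "Matrix.vec_index (block_hankel u n *\<^sub>v w r) p
      = (\<Sum>k\<le>n. moment u (p div m + k) *v r k) $ e (p mod m)" if "p < (n + 1) * m" for p r
    using that unfolding w_def m_def e_def by (rule block_hankel_mult_vec)
  have A: "block_hankel u n \<in> carrier_mat ((n + 1) * m) ((n + 1) * m)"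
    by (simp add: block_hankel_def Let_def m_def)
  have w: "Matrix.vec_index (w r) (k * m + d t) = r k $ t" if "k \<le> n" for r k t
  proof -
    have "k * m + d t < k * m + m" using dm by simp
    also have "\<dots> \<le> (n + 1) * m" using that by simp
    finally show ?thesis using dm [of t] by (simp add: w_def ed)
  qed
  have ker: "block_hankel u n *\<^sub>v w r = 0\<^sub>v ((n + 1) * m)
      \<longleftrightarrow> (\<forall>i\<le>n. (\<Sum>k\<le>n. moment u (i + k) *v r k) = 0)" (is "?L \<longleftrightarrow> ?R") for r
  proof
    assume L: ?L
    show ?R
    proof (intro allI impI)
      fix i assume "i \<le> n"
      show "(\<Sum>k\<le>n. moment u (i + k) *v r k) = 0"
        unfolding cvec_eq_iff
      proof
        fix t
        have "i * m + d t < i * m + m" using dm by simp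
        also have "\<dots> \<le> (n + 1) * m" using \<open>i \<le> n\<close> by simp
        finally have lt: "i * m + d t < (n + 1) * m" .
        then show "(\<Sum>k\<le>n. moment u (i + k) *v r k) $ t = 0 $ t"
          using mv [OF lt, of r] L dm [of t] m by (simp add: ed)
      qed
    qed
  next
    assume R: ?R
    show ?L
    proof (rule eq_vecI)
      fix p assume "p < dim_vec (0\<^sub>v ((n + 1) * m) :: complex Matrix.vec)"
      then have p: "p < (n + 1) * m" by simp
      then have "p div m \<le> n"
        using less_mult_imp_div_less [of p "n + 1" m] by simp
      then show "Matrix.vec_index (block_hankel u n *\<^sub>v w r) p = Matrix.vec_index (0\<^sub>v ((n + 1) * m)) p"
        using mv [OF p, of r] R p by (simp only: zero_index index_zero_vec)
    qed (use A in simp)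
  qed
  have w0: "w r = 0\<^sub>v ((n + 1) * m) \<longleftrightarrow> (\<forall>k\<le>n. r k = 0)" (is "?L \<longleftrightarrow> ?R") for r
  proof
    assume L: ?L
    have "r k $ t = 0" if "k \<le> n" for k t
    proof -
      have "k * m + d t < k * m + m" using dm by simp
      also have "\<dots> \<le> (n + 1) * m" using that by simp
      finally show ?thesis using w [OF that, of r t] L by simp
    qed
    then show ?R by (simp add: cvec_eq_iff)
  next
    assume R: ?R
    show ?L
    proof (rule eq_vecI)
      fix p assume "p < dim_vec (0\<^sub>v ((n + 1) * m) :: complex Matrix.vec)"
      then have p: "p < (n + 1) * m" by simp
      then have "p div m \<le> n"
        using less_mult_imp_div_less [of p "n + 1" m] by simp
      with p R show "Matrix.vec_index (w r) p = Matrix.vec_index (0\<^sub>v ((n + 1) * m)) p"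
        by (simp add: w_def)
    qed (simp add: w_def)
  qed
  have surj: "\<exists>r. (\<forall>k>n. r k = 0) \<and> w r = v" if "v \<in> carrier_vec ((n + 1) * m)" for v
  proof -
    define r where "r k = (if k \<le> n then (\<chi> t. Matrix.vec_index v (k * m + d t)) else 0)" for k
    have "w r = v"
    proof (rule eq_vecI)
      fix p assume "p < dim_vec v"
      then have p: "p < (n + 1) * m" using that by simp
      then have "p div m \<le> n"
        using less_mult_imp_div_less [of p "n + 1" m] by simp
      with p m show "Matrix.vec_index (w r) p = Matrix.vec_index v p"
        by (simp add: w_def r_def de)
    qed (use that in \<open>simp add: w_def\<close>)
    then show ?thesis by (intro exI [of _ r]) (simp add: r_def)
  qed
  have wc: "w r \<in> carrier_vec ((n + 1) * m)" for r
    by (simp add: w_def)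
  have "Determinant.det (block_hankel u n) = 0 \<longleftrightarrow>
      (\<exists>r. (\<forall>k>n. r k = 0) \<and> w r \<noteq> 0\<^sub>v ((n + 1) * m) \<and> block_hankel u n *\<^sub>v w r = 0\<^sub>v ((n + 1) * m))"
    unfolding det_0_iff_vec_prod_zero [OF A] using surj wc by metis
  also have "\<dots> \<longleftrightarrow> \<not> nondegenerate (moment u) n"
    unfolding nondegenerate_def ker w0 fun_eq_iff by (metis linorder_not_le)
  finally show ?thesis by blast
qed

lemma quasi_definite_iff: "quasi_definite u \<longleftrightarrow> (\<forall>n. nondegenerate (moment u) n)"
  by (simp add: quasi_definite_def det_block_hankel)

subsection \<open>Functionals and their moments\<close>

lemma left_linear_0:
  assumes "left_linear u"
  shows "u 0 = 0"
proof -
  have "u (lmult_poly 0 0) = 0 ** u 0"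
    using assms unfolding left_linear_def by blast
  then show ?thesis by (simp add: lmult_poly_def)
qed

lemma left_linear_sum:
  assumes "left_linear u" "finite I"
  shows "u (sum f I) = (\<Sum>i\<in>I. u (f i))"
  using assms(2)
  by induction (use assms(1) in \<open>auto simp: left_linear_0 left_linear_def\<close>)

lemma left_linear_monom:
  assumes "left_linear u"
  shows "u (monom C k) = C ** moment u k"
proof -
  have "monom C k = lmult_poly C (monom (mat 1) k)"
    by (simp add: poly_eq_iff coeff_lmult_poly)
  then show ?thesis
    using assms by (simp add: left_linear_def moment_def)
qed

lemma left_linear_expand:
  assumes "left_linear u" "degree P \<le> n"
  shows "u P = (\<Sum>k\<le>n. coeff P k ** moment u k)"
proof -
  have "u P = u (\<Sum>k\<le>n. monom (coeff P k) k)"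
    using poly_as_sum_of_monoms' [OF assms(2)] by simp
  then show ?thesis
    by (simp add: left_linear_sum left_linear_monom assms(1))
qed

text \<open>Both sides of the Pearson equation are left linear, so this reduces it to
  moments.\<close>

lemma left_linear_eqI:
  assumes "left_linear u" "left_linear v" "\<And>n. moment u n = moment v n"
  shows "u = v"
  using assms by (simp add: fun_eq_iff left_linear_expand [OF _ order_refl])

lemma coeff_xpow_mult: "coeff (xpow_mult k P) n = (if n < k then 0 else coeff P (n - k))"
proof -
  have "coeff (xpow_mult k P) n = (if n < k then 0 else coeff P (n - k))" for n
    unfolding xpow_mult_def by (induction k arbitrary: n) (auto simp: coeff_pCons split: nat.splits)
  then show ?thesis .
qed

lemma left_linear_fun_mult_poly:
  fixes u :: "'m::finite mfunctional"
  assumes u: "left_linear u"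
  shows "left_linear (fun_mult_poly u Q)"
proof -
  have "xpow_mult k (P + P') = xpow_mult k P + xpow_mult k P'"
    and "xpow_mult k (lmult_poly A P) = lmult_poly A (xpow_mult k P)" for k A and P P' :: "'m cmat poly"
    by (simp_all add: poly_eq_iff coeff_xpow_mult coeff_lmult_poly)
  then show ?thesis
    using u by (auto simp: left_linear_def fun_mult_poly_def matrix_add_rdistrib sum.distrib
        matrix_mult_sum matrix_mul_assoc)
qed

lemma left_linear_deriv_fun:
  fixes u :: "'m::finite mfunctional"
  assumes u: "left_linear u"
  shows "left_linear (deriv_fun u)"
proof -
  have "deriv_poly (P + P') = deriv_poly P + deriv_poly P'"
    and "deriv_poly (lmult_poly A P) = lmult_poly A (deriv_poly P)" for A and P P' :: "'m cmat poly"
    by (simp_all add: poly_eq_iff coeff_deriv_poly coeff_lmult_poly matrix_add_ldistrib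
        mat_mul_left_commute)
  then show ?thesis
    using u by (simp add: left_linear_def deriv_fun_def matrix_mult_minus)
qed

lemma left_linear_lmult_fun:
  fixes u :: "'m::finite mfunctional"
  assumes u: "left_linear u"
  shows "left_linear (lmult_fun A u)"
proof -
  have "rmult_poly (P + P') A = rmult_poly P A + rmult_poly P' A"
    and "rmult_poly (lmult_poly B P) A = lmult_poly B (rmult_poly P A)" for P P' B
    by (simp_all add: poly_eq_iff coeff_rmult_poly coeff_lmult_poly matrix_add_rdistrib
        matrix_mul_assoc)
  then show ?thesis
    using u by (simp add: left_linear_def lmult_fun_def)
qed

text \<open>The free bound \<open>d\<close> keeps the number of terms fixed even when leading
  coefficients such as \<alpha>2 or \<psi>1 vanish.\<close>

lemma moment_fun_mult_poly:
  fixes u :: "'m::finite mfunctional"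
  assumes "degree Q \<le> d"
  shows "moment (fun_mult_poly u Q) n = (\<Sum>k\<le>d. moment u (n + k) ** coeff Q k)"
proof -
  have "xpow_mult k (monom (mat 1 :: 'm cmat) n) = monom (mat 1) (n + k)" for k
    by (auto simp: poly_eq_iff coeff_xpow_mult)
  then have "moment (fun_mult_poly u Q) n = (\<Sum>k\<le>degree Q. moment u (n + k) ** coeff Q k)"
    by (simp add: moment_def fun_mult_poly_def)
  also have "\<dots> = (\<Sum>k\<le>d. moment u (n + k) ** coeff Q k)"
    using assms by (intro sum.mono_neutral_left) (auto simp: coeff_eq_0)
  finally show ?thesis .
qed

text \<open>At n = 0 the truncated index \<open>n - 1\<close> is 0, but its factor vanishes;
  \<open>pearson_rec\<close> relies on the same convention.\<close>

lemma moment_deriv_fun: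
  fixes u :: "'m::finite mfunctional"
  assumes u: "left_linear u"
  shows "moment (deriv_fun u) n = - (mat (of_nat n) ** moment u (n - 1))"
proof -
  have "deriv_poly (monom (mat 1 :: 'm cmat) n) = monom (mat (of_nat n)) (n - 1)"
    by (cases n) (auto simp: poly_eq_iff coeff_deriv_poly)
  then show ?thesis
    by (simp add: moment_def [of "\<lambda>P. - u (deriv_poly P)"] deriv_fun_def left_linear_monom [OF u])
qed

lemma moment_lmult_fun:
  assumes u: "left_linear u"
  shows "moment (lmult_fun A u) n = A ** moment u n"
proof -
  have "rmult_poly (monom (mat 1) n) A = monom A n"
    by (simp add: poly_eq_iff coeff_rmult_poly)
  then show ?thesis
    by (simp add: moment_def [of "\<lambda>P. u (rmult_poly P A)"] lmult_fun_def left_linear_monom [OF u])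
qed

definition functional_of_moments :: "(nat \<Rightarrow> 'm::finite cmat) \<Rightarrow> 'm mfunctional" where
  "functional_of_moments \<mu> = (\<lambda>P. \<Sum>k\<le>degree P. coeff P k ** \<mu> k)"

lemma functional_of_moments_expand:
  assumes "degree P \<le> n"
  shows "functional_of_moments \<mu> P = (\<Sum>k\<le>n. coeff P k ** \<mu> k)"
  unfolding functional_of_moments_def using assms
  by (intro sum.mono_neutral_left) (auto simp: coeff_eq_0)

lemma left_linear_functional_of_moments: "left_linear (functional_of_moments \<mu>)"
proof -
  have "functional_of_moments \<mu> (P + Q) = functional_of_moments \<mu> P + functional_of_moments \<mu> Q" for P Q
  proof -
    define n where "n = max (degree P) (degree Q)"
    have "degree P \<le> n" "degree Q \<le> n" "degree (P + Q) \<le> n"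
      by (simp_all add: n_def degree_add_le_max)
    then show ?thesis
      by (simp add: functional_of_moments_expand matrix_add_rdistrib sum.distrib)
  qed
  moreover have "functional_of_moments \<mu> (lmult_poly A P) = A ** functional_of_moments \<mu> P" for A P
  proof -
    have "degree (lmult_poly A P) \<le> degree P"
      by (rule degree_le) (simp add: coeff_lmult_poly coeff_eq_0)
    then show ?thesis
      by (simp add: functional_of_moments_expand [of _ "degree P"] coeff_lmult_poly matrix_mult_sum matrix_mul_assoc)
  qed
  ultimately show ?thesis
    by (simp add: left_linear_def)
qed

lemma moment_functional_of_moments: "moment (functional_of_moments \<mu>) n = \<mu> n"
proof -
  have "moment (functional_of_moments \<mu>) n = (\<Sum>k\<le>n. coeff (monom (mat 1) n) k ** \<mu> k)"
    unfolding moment_def by (rule functional_of_moments_expand) (rule degree_monom_le)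
  also have "\<dots> = (\<Sum>k\<le>n. if k = n then \<mu> n else 0)"
    by (intro sum.cong) auto
  finally show ?thesis by simp
qed

subsection \<open>The Pearson recurrence\<close>

context
  fixes \<alpha>0 \<alpha>1 \<alpha>2 :: complex
begin

definition coeffN :: "'m::finite cmat \<Rightarrow> nat \<Rightarrow> 'm cmat" where
  "coeffN \<psi>0 n = \<psi>0 + mat (of_nat n * \<alpha>1)"

definition coeffM :: "'m::finite cmat \<Rightarrow> nat \<Rightarrow> 'm cmat" where
  "coeffM \<psi>1 n = \<psi>1 + mat (of_nat n * \<alpha>2)"

definition pearson_rec :: "'m::finite cmat \<Rightarrow> 'm cmat \<Rightarrow> (nat \<Rightarrow> 'm cmat) \<Rightarrow> bool" where
  "pearson_rec \<psi>0 \<psi>1 \<mu> \<longleftrightarrow>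
     (\<forall>n. \<mu> (Suc n) ** coeffM \<psi>1 n + \<mu> n ** coeffN \<psi>0 n + mat (of_nat n * \<alpha>0) ** \<mu> (n - 1) = 0)"

text \<open>These are the moments of v = u\<alpha>; scalar matrices commute with all others, so they
  may stand on the left.\<close>

definition mult_alpha :: "(nat \<Rightarrow> 'm::finite cmat) \<Rightarrow> nat \<Rightarrow> 'm cmat" where
  "mult_alpha \<mu> n = mat \<alpha>0 ** \<mu> n + mat \<alpha>1 ** \<mu> (n + 1) + mat \<alpha>2 ** \<mu> (n + 2)"

text \<open>The coefficient of x^k in T r = \<alpha>r' + \<Psi>r: the terms in r_(k-1) combine into
  M_(k-1), those in r_k into N_k, and \<alpha>0 r' contributes the last summand.\<close>

definition pearson_op ::
  "'m::finite cmat \<Rightarrow> 'm cmat \<Rightarrow> (nat \<Rightarrow> complex^'m) \<Rightarrow> nat \<Rightarrow> complex^'m" where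
  "pearson_op \<psi>0 \<psi>1 r k =
     (if k = 0 then 0 else coeffM \<psi>1 (k - 1) *v r (k - 1)) + coeffN \<psi>0 k *v r k
     + (of_nat (k + 1) * \<alpha>0) *s r (k + 1)"

lemma coeffM_vec: "coeffM \<psi>1 n *v x = \<psi>1 *v x + (of_nat n * \<alpha>2) *s x"
  by (simp add: coeffM_def matrix_vector_mult_add_rdistrib mat_vector_mult)

lemma coeffN_vec: "coeffN \<psi>0 n *v x = \<psi>0 *v x + (of_nat n * \<alpha>1) *s x"
  by (simp add: coeffN_def matrix_vector_mult_add_rdistrib mat_vector_mult)

lemma mult_alpha_vec:
  "mult_alpha \<mu> n *v x = \<alpha>0 *s (\<mu> n *v x) + \<alpha>1 *s (\<mu> (n + 1) *v x) + \<alpha>2 *s (\<mu> (n + 2) *v x)"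
  by (simp add: mult_alpha_def matrix_vector_mult_add_rdistrib mat_vector_mult
      flip: matrix_vector_mul_assoc)

lemma coeffM_shift: "coeffM (\<psi>1 + mat (2 * \<alpha>2)) n = coeffM \<psi>1 (n + 2)"
  by (simp add: coeffM_def cvec_eq_iff Finite_Cartesian_Product.mat_def algebra_simps)

text \<open>On column vectors scalar matrices become scalar multiplications; taking coordinates then
  leaves identities between complex numbers.\<close>

lemma pearson_rec_iff_vec:
  "pearson_rec \<psi>0 \<psi>1 \<mu> \<longleftrightarrow>
    (\<forall>n x. \<mu> (Suc n) *v (\<psi>1 *v x) + (of_nat n * \<alpha>2) *s (\<mu> (Suc n) *v x) + \<mu> n *v (\<psi>0 *v x)
      + (of_nat n * \<alpha>1) *s (\<mu> n *v x) + (of_nat n * \<alpha>0) *s (\<mu> (n - 1) *v x) = 0)"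
  unfolding pearson_rec_def matrix_eq
  by (simp add: matrix_vector_mult_add_rdistrib coeffM_vec coeffN_vec mat_vector_mult
        matrix_vector_right_distrib vector_scalar_commute add_ac flip: matrix_vector_mul_assoc)

lemma pearson_rec_vec:
  assumes "pearson_rec \<psi>0 \<psi>1 \<mu>"
  shows "\<mu> (Suc n) *v (\<psi>1 *v x) + (of_nat n * \<alpha>2) *s (\<mu> (Suc n) *v x) + \<mu> n *v (\<psi>0 *v x)
    + (of_nat n * \<alpha>1) *s (\<mu> n *v x) + (of_nat n * \<alpha>0) *s (\<mu> (n - 1) *v x) = 0"
  using assms unfolding pearson_rec_iff_vec by blast

text \<open>In the recurrence at index i + k the factor n splits as i + k. The k-share gives the
  action of T on the monomial with coefficient \<open>x\<close> in degree k, and the i-share gives a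
  moment of v. For i = 0 that share vanishes, so the truncated \<open>i - 1\<close> is
  harmless.\<close>

lemma pearson_rec_term:
  assumes "pearson_rec \<psi>0 \<psi>1 \<mu>"
  shows "\<mu> (i + Suc k) *v (coeffM \<psi>1 k *v x) + \<mu> (i + k) *v (coeffN \<psi>0 k *v x)
    + (of_nat k * \<alpha>0) *s (\<mu> (i + k - 1) *v x) = - of_nat i *s (mult_alpha \<mu> (i - 1 + k) *v x)"
proof (cases i)
  case 0
  then show ?thesis using pearson_rec_vec [OF assms, of k x]
    by (simp add: coeffM_vec coeffN_vec matrix_vector_right_distrib vector_scalar_commute add_ac)
next
  case (Suc j)
  have lin: "p + (q + k*a1*m0) + k*a2*m1 + k*a0*z = - (i*(a0*z + a1*m0 + a2*m1))"
    if "p + (i + k)*a2*m1 + q + (i + k)*a1*m0 + (i + k)*a0*z = 0"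
    for a0 a1 a2 i k p q m0 m1 z :: complex
  proof -
    have "p + (q + k*a1*m0) + k*a2*m1 + k*a0*z + i*(a0*z + a1*m0 + a2*m1)
        = p + (i + k)*a2*m1 + q + (i + k)*a1*m0 + (i + k)*a0*z"
      by (simp add: algebra_simps)
    then show ?thesis using that by (simp only: add_eq_0_iff2)
  qed
  have "(\<mu> (Suc (i + k)) *v (\<psi>1 *v x)) $ s + (of_nat i + of_nat k)*\<alpha>2*(\<mu> (Suc (i + k)) *v x) $ s
      + (\<mu> (i + k) *v (\<psi>0 *v x)) $ s + (of_nat i + of_nat k)*\<alpha>1*(\<mu> (i + k) *v x) $ s
      + (of_nat i + of_nat k)*\<alpha>0*(\<mu> (i + k - 1) *v x) $ s = 0" for s
    using pearson_rec_vec [OF assms, of "i + k" x, unfolded cvec_eq_iff, rule_format, of s]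
    by simp
  note lin = lin [OF this]
  show ?thesis
    unfolding cvec_eq_iff
  proof
    fix s
    show "(\<mu> (i + Suc k) *v (coeffM \<psi>1 k *v x) + \<mu> (i + k) *v (coeffN \<psi>0 k *v x)
        + (of_nat k * \<alpha>0) *s (\<mu> (i + k - 1) *v x)) $ s
        = (- of_nat i *s (mult_alpha \<mu> (i - 1 + k) *v x)) $ s"
      using lin [of s] by (simp add: Suc coeffM_vec coeffN_vec matrix_vector_right_distrib
        vector_scalar_commute mult_alpha_vec) (simp add: algebra_simps)
  qed
qed

text \<open>The sum of \<open>pearson_rec_term\<close> over the coefficients of \<open>r\<close>,
  once the three parts of T are reindexed. The limit n + 1 appears because T raises the degree by at
  most one.\<close>

lemma sum_pearson_op:
  assumes rec: "pearson_rec \<psi>0 \<psi>1 \<mu>" and supp: "\<forall>k>n. r k = 0"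
  shows "(\<Sum>k\<le>Suc n. \<mu> (i + k) *v pearson_op \<psi>0 \<psi>1 r k)
    = - of_nat i *s (\<Sum>k\<le>n. mult_alpha \<mu> (i - 1 + k) *v r k)"
proof -
  define g where "g k = (of_nat k * \<alpha>0) *s (\<mu> (i + k - 1) *v r k)" for k
  have S1: "(\<Sum>k\<le>Suc n. \<mu> (i + k) *v (if k = 0 then 0 else coeffM \<psi>1 (k - 1) *v r (k - 1)))
      = (\<Sum>k\<le>n. \<mu> (i + Suc k) *v (coeffM \<psi>1 k *v r k))"
    unfolding sum.atMost_Suc_shift by simp
  have S2: "(\<Sum>k\<le>Suc n. \<mu> (i + k) *v (coeffN \<psi>0 k *v r k))
      = (\<Sum>k\<le>n. \<mu> (i + k) *v (coeffN \<psi>0 k *v r k))"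
    using supp by simp
  \<comment> \<open>The index shift introduces \<open>g 0\<close>, which is zero by its factor k;
    the terms above n vanish by \<open>supp\<close>.\<close>
  have "(\<Sum>k\<le>Suc n. \<mu> (i + k) *v ((of_nat (k + 1) * \<alpha>0) *s r (k + 1))) = (\<Sum>k\<le>Suc n. g (Suc k))"
    unfolding g_def by (intro sum.cong) (simp_all add: vector_scalar_commute)
  also have "\<dots> = (\<Sum>k\<le>Suc (Suc n). g k)"
    unfolding sum.atMost_Suc_shift [of g "Suc n"] by (simp add: g_def)
  also have "\<dots> = (\<Sum>k\<le>n. g k)"
    using supp by (simp add: g_def)
  finally have S3: "(\<Sum>k\<le>Suc n. \<mu> (i + k) *v ((of_nat (k + 1) * \<alpha>0) *s r (k + 1))) = (\<Sum>k\<le>n. g k)" .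
  have "(\<Sum>k\<le>Suc n. \<mu> (i + k) *v pearson_op \<psi>0 \<psi>1 r k)
      = (\<Sum>k\<le>n. \<mu> (i + Suc k) *v (coeffM \<psi>1 k *v r k) + \<mu> (i + k) *v (coeffN \<psi>0 k *v r k) + g k)"
    unfolding pearson_op_def matrix_vector_right_distrib sum.distrib S1 S2 S3 ..
  also have "\<dots> = (\<Sum>k\<le>n. - of_nat i *s (mult_alpha \<mu> (i - 1 + k) *v r k))"
    unfolding g_def by (intro sum.cong refl pearson_rec_term rec)
  also have "\<dots> = - of_nat i *s (\<Sum>k\<le>n. mult_alpha \<mu> (i - 1 + k) *v r k)"
    by (simp add: vec.scale_sum_right sum_negf)
  finally show ?thesis .
qed

section \<open>Solving with the triangular operator T\<close>

lemma pearson_op_diff: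
  "pearson_op \<psi>0 \<psi>1 (\<lambda>k. r k - s k) k = pearson_op \<psi>0 \<psi>1 r k - pearson_op \<psi>0 \<psi>1 s k"
  by (simp add: pearson_op_def algebra_simps vec.scale_right_diff_distrib)

text \<open>The top coefficient involves M_(n-1) alone, so the equations are solved from the top
  down. Coefficient 0 stays uncontrolled: n unknowns meet the n equations 1..n.\<close>

lemma pearson_op_solve:
  assumes "\<forall>k<n. invertible (coeffM \<psi>1 k)"
  shows "\<exists>r. (\<forall>k\<ge>n. r k = 0) \<and> (\<forall>k\<in>{1..n}. pearson_op \<psi>0 \<psi>1 r k = s k)"
  using assms
proof (induction n arbitrary: s)
  case 0
  show ?case by (rule exI [of _ "\<lambda>_. 0"]) simp
next
  case (Suc n)
  \<comment> \<open>Minus the leading monomial of the solution; the induction hypothesis absorbs its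
    lower-order contributions.\<close>
  define e where "e k = (if k = n then - (matrix_inv (coeffM \<psi>1 n) *v s (Suc n)) else 0)" for k
  have e_top: "pearson_op \<psi>0 \<psi>1 e (Suc n) = - s (Suc n)"
    using Suc.prems by (simp add: pearson_op_def e_def matrix_vector_mult_minus
        matrix_vector_mul_assoc invertible_matrix_inv)
  have "\<exists>r. (\<forall>k\<ge>n. r k = 0) \<and>
      (\<forall>k\<in>{1..n}. pearson_op \<psi>0 \<psi>1 r k = s k + pearson_op \<psi>0 \<psi>1 e k)"
    using Suc.prems by (intro Suc.IH) simp
  then obtain r where r: "\<forall>k\<ge>n. r k = 0"
      "\<forall>k\<in>{1..n}. pearson_op \<psi>0 \<psi>1 r k = s k + pearson_op \<psi>0 \<psi>1 e k"
    by blast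
  have "pearson_op \<psi>0 \<psi>1 r (Suc n) = 0"
    using r(1) by (simp add: pearson_op_def)
  with e_top r have "\<forall>k\<in>{1..Suc n}. pearson_op \<psi>0 \<psi>1 (\<lambda>k. r k - e k) k = s k"
    by (auto simp: pearson_op_diff atLeastAtMostSuc_conv)
  moreover have "\<forall>k\<ge>Suc n. r k - e k = 0"
    using r(1) by (simp add: e_def)
  ultimately show ?case
    by (intro exI [of _ "\<lambda>k. r k - e k"] conjI)
qed

lemma pearson_op_support: "\<forall>k\<ge>n. r k = 0 \<Longrightarrow> \<forall>k>n. pearson_op \<psi>0 \<psi>1 r k = 0"
  by (auto simp: pearson_op_def)

text \<open>For \<open>r\<close> of degree at most n, T r has coefficient M_n r_n in degree n + 1;
  its vanishing lowers the degree bound one step at a time.\<close>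

lemma pearson_op_inj:
  assumes "\<forall>k<n. invertible (coeffM \<psi>1 k)" "\<forall>k\<ge>n. r k = 0"
    and "\<forall>k\<ge>1. pearson_op \<psi>0 \<psi>1 r k = 0"
  shows "r = (\<lambda>_. 0)"
  using assms
proof (induction n)
  case 0
  then show ?case by auto
next
  case (Suc n)
  then have "pearson_op \<psi>0 \<psi>1 r (Suc n) = coeffM \<psi>1 n *v r n"
    by (simp add: pearson_op_def)
  with Suc.prems have "r n = 0"
    by (metis One_nat_def invertible_iff_kernel le_add1 lessI plus_1_eq_Suc)
  with Suc.prems(2) have "\<forall>k\<ge>n. r k = 0"
    by (metis Suc_leI le_neq_implies_less)
  with Suc show ?case by simp
qed

section \<open>Multiplication by \<alpha> on the polynomial side\<close>

definition alpha_times :: "(nat \<Rightarrow> complex^'m::finite) \<Rightarrow> nat \<Rightarrow> complex^'m" where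
  "alpha_times r k = \<alpha>0 *s r k + (if k < 1 then 0 else \<alpha>1 *s r (k - 1))
     + (if k < 2 then 0 else \<alpha>2 *s r (k - 2))"

lemma sum_alpha_times:
  assumes supp: "\<forall>k>n. r k = 0"
  shows "(\<Sum>k\<le>n + 2. \<mu> (i + k) *v alpha_times r k) = (\<Sum>k\<le>n. mult_alpha \<mu> (i + k) *v r k)"
proof -
  have 1: "(\<Sum>k\<le>Suc (Suc n). \<mu> (i + k) *v (\<alpha>0 *s r k)) = (\<Sum>k\<le>n. \<alpha>0 *s (\<mu> (i + k) *v r k))"
    using supp by (simp add: vector_scalar_commute)
  have 2: "(\<Sum>k\<le>Suc (Suc n). \<mu> (i + k) *v (if k < 1 then 0 else \<alpha>1 *s r (k - 1)))
      = (\<Sum>k\<le>n. \<alpha>1 *s (\<mu> (i + k + 1) *v r k))"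
    unfolding sum.atMost_Suc_shift [of _ "Suc n"] using supp by (simp add: vector_scalar_commute)
  have 3: "(\<Sum>k\<le>Suc (Suc n). \<mu> (i + k) *v (if k < 2 then 0 else \<alpha>2 *s r (k - 2)))
      = (\<Sum>k\<le>n. \<alpha>2 *s (\<mu> (i + k + 2) *v r k))"
    unfolding sum.atMost_Suc_shift [of _ "Suc n"] sum.atMost_Suc_shift [of _ n] using supp
    by (simp add: vector_scalar_commute)
  show ?thesis
    unfolding alpha_times_def matrix_vector_right_distrib sum.distrib add_2_eq_Suc' 1 2 3
    by (simp add: mult_alpha_vec sum.distrib add_ac)
qed

text \<open>In each coordinate this is a vanishing product in the integral domain of complex
  polynomials, with the nonzero factor \<alpha>.\<close>

lemma alpha_times_eq_0:
  assumes alpha: "[:\<alpha>0, \<alpha>1, \<alpha>2:] \<noteq> 0" and supp: "\<forall>k>n. r k = 0"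
    and 0: "\<forall>k. alpha_times r k = 0"
  shows "r = (\<lambda>_. 0)"
proof (rule ext)
  fix k
  show "r k = 0"
    unfolding cvec_eq_iff
  proof (rule allI)
    fix s
    define p where "p = (\<Sum>k\<le>n. monom (r k $ s) k)"
    have cp: "coeff p k = r k $ s" for k
      using supp by (auto simp: p_def coeff_sum)
    have "coeff ([:\<alpha>0, \<alpha>1, \<alpha>2:] * p) k = alpha_times r k $ s" for k
      by (cases k; cases "k - 1") (simp_all add: alpha_times_def coeff_pCons cp)
    then have "[:\<alpha>0, \<alpha>1, \<alpha>2:] * p = 0"
      using 0 by (simp add: poly_eq_iff)
    with alpha have "p = 0"
      using mult_eq_0_iff by blast
    then show "r k $ s = 0 $ s" using cp [of k] by simp
  qed
qed

lemma coeffM_invertible: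
  assumes alpha: "[:\<alpha>0, \<alpha>1, \<alpha>2:] \<noteq> 0" and rec: "pearson_rec \<psi>0 \<psi>1 \<mu>"
    and nd: "\<And>n. nondegenerate \<mu> n"
  shows "invertible (coeffM \<psi>1 n)"
proof (induction n rule: less_induct)
  case (less n)
  show ?case
    unfolding invertible_iff_kernel
  proof (intro allI impI)
    fix w assume w: "coeffM \<psi>1 n *v w = 0"
    define e where "e k = (if k = n then w else 0)" for k
    obtain r where r: "\<forall>k\<ge>n. r k = 0"
        "\<forall>k\<in>{1..n}. pearson_op \<psi>0 \<psi>1 r k = pearson_op \<psi>0 \<psi>1 e k"
      using pearson_op_solve [of n] less by metis
    \<comment> \<open>This is w x^n plus lower terms, with \<open>r\<close> cancelling the
      coefficients 1..n of T. Finding \<open>r\<close> needs M_0, ..., M_(n-1), hence the strong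
      induction.\<close>
    define q where "q k = e k - r k" for k
    have supp: "\<forall>k>n. q k = 0"
      using r(1) by (simp add: q_def e_def)
    have "pearson_op \<psi>0 \<psi>1 q k = 0" if "k \<ge> 1" for k
    proof (cases "k \<le> n")
      case True
      then show ?thesis using r(2) that by (simp add: q_def [abs_def] pearson_op_diff)
    next
      case False
      then have "q k = 0" "q (Suc k) = 0"
        using supp by simp_all
      \<comment> \<open>For k = n + 1 the value is M_n w, zero by the choice of \<open>w\<close>;
        beyond that the support of \<open>q\<close> suffices.\<close>
      moreover have "coeffM \<psi>1 (k - 1) *v q (k - 1) = 0"
        using False supp w r(1) by (cases "k - 1 = n") (simp_all add: q_def e_def)
      ultimately show ?thesis
        by (simp add: pearson_op_def)
    qed
    then have op: "(\<Sum>k\<le>Suc n. \<mu> (i + k) *v pearson_op \<psi>0 \<psi>1 q k) = \<mu> i *v pearson_op \<psi>0 \<psi>1 q 0" for i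
      unfolding sum.atMost_Suc_shift by simp
    have "\<mu> 0 *v pearson_op \<psi>0 \<psi>1 q 0 = 0"
      using sum_pearson_op [OF rec supp, of 0] op [of 0] by simp
    then have op0: "pearson_op \<psi>0 \<psi>1 q 0 = 0"
      using nd [of 0] unfolding nondegenerate_0 invertible_iff_kernel by blast
    have "(\<Sum>k\<le>n. mult_alpha \<mu> (i + k) *v q k) = 0" for i
    proof -
      have "- of_nat (Suc i) *s (\<Sum>k\<le>n. mult_alpha \<mu> (i + k) *v q k) = 0"
        using sum_pearson_op [OF rec supp, of "Suc i"] op [of "Suc i"] op0 by simp
      then show ?thesis
        by (simp add: vec.scale_eq_0_iff del: of_nat_Suc)
    qed
    then have "(\<Sum>k\<le>n + 2. \<mu> (i + k) *v alpha_times q k) = 0" for i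
      by (simp only: sum_alpha_times [OF supp])
    moreover have "\<forall>k>n + 2. alpha_times q k = 0"
      using supp by (simp add: alpha_times_def)
    ultimately have "alpha_times q = (\<lambda>_. 0)"
      using nd [of "n + 2"] unfolding nondegenerate_def by blast
    then have "q = (\<lambda>_. 0)"
      by (intro alpha_times_eq_0 [OF alpha supp]) simp
    moreover have "q n = w"
      using r(1) by (simp add: q_def e_def)
    ultimately show "w = 0" by simp
  qed
qed

text \<open>T maps the kernel of v in degree n into that of u in degree n + 1: row 0 is zero, and
  row i + 1 for u is -(i + 1) times row i for v. \<open>pearson_op_inj\<close> and
  \<open>pearson_op_solve\<close> give the two directions.\<close>

lemma nondegenerate_Suc:
  assumes rec: "pearson_rec \<psi>0 \<psi>1 \<mu>" and M: "\<And>n. invertible (coeffM \<psi>1 n)"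
    and mu0: "invertible (\<mu> 0)"
  shows "nondegenerate \<mu> (Suc n) \<longleftrightarrow> nondegenerate (mult_alpha \<mu>) n"
proof
  assume nd: "nondegenerate \<mu> (Suc n)"
  show "nondegenerate (mult_alpha \<mu>) n"
    unfolding nondegenerate_def
  proof (intro allI impI)
    fix r assume supp: "\<forall>k>n. r k = 0" and ker: "\<forall>i\<le>n. (\<Sum>k\<le>n. mult_alpha \<mu> (i + k) *v r k) = 0"
    have "(\<Sum>k\<le>Suc n. \<mu> (i + k) *v pearson_op \<psi>0 \<psi>1 r k) = 0" if "i \<le> Suc n" for i
      unfolding sum_pearson_op [OF rec supp] using ker that by (cases i) simp_all
    moreover have "\<forall>k>Suc n. pearson_op \<psi>0 \<psi>1 r k = 0"
      using supp by (intro pearson_op_support) simp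
    ultimately have "pearson_op \<psi>0 \<psi>1 r = (\<lambda>_. 0)"
      using nd unfolding nondegenerate_def by blast
    then show "r = (\<lambda>_. 0)"
      using supp by (intro pearson_op_inj [of "Suc n" \<psi>1 r \<psi>0] M allI impI) simp_all
  qed
next
  assume R: "nondegenerate (mult_alpha \<mu>) n"
  show "nondegenerate \<mu> (Suc n)"
    unfolding nondegenerate_def
  proof (intro allI impI)
    fix s assume supp: "\<forall>k>Suc n. s k = 0" and ker: "\<forall>i\<le>Suc n. (\<Sum>k\<le>Suc n. \<mu> (i + k) *v s k) = 0"
    obtain r where r: "\<forall>k\<ge>Suc n. r k = 0" "\<forall>k\<in>{1..Suc n}. pearson_op \<psi>0 \<psi>1 r k = s k"
      using pearson_op_solve [of "Suc n" \<psi>1 \<psi>0 s] M by blast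
    then have rsupp: "\<forall>k>n. r k = 0" by simp
    have op: "pearson_op \<psi>0 \<psi>1 r k = s k" if "k \<ge> 1" for k
      using r supp that pearson_op_support [OF r(1)] by (cases "k \<le> Suc n") simp_all
    \<comment> \<open>Row 0 of u vanishes on both \<open>s\<close> and T r, which differ at most in
      the constant coefficient; invertibility of \<mu>_0 then forces T r = s.\<close>
    have "(\<Sum>k\<le>Suc n. \<mu> k *v (s k - pearson_op \<psi>0 \<psi>1 r k)) = 0"
      using ker [rule_format, of 0] sum_pearson_op [OF rec rsupp, of 0]
      by (simp add: algebra_simps sum_subtractf del: sum.atMost_Suc)
    then have "\<mu> 0 *v (s 0 - pearson_op \<psi>0 \<psi>1 r 0) = 0"
      unfolding sum.atMost_Suc_shift by (simp add: op)
    then have "s 0 - pearson_op \<psi>0 \<psi>1 r 0 = 0"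
      using mu0 unfolding invertible_iff_kernel by blast
    then have op_r: "pearson_op \<psi>0 \<psi>1 r = s"
      using op by (metis One_nat_def Suc_leI eq_iff_diff_eq_0 ext neq0_conv)
    have "(\<Sum>k\<le>n. mult_alpha \<mu> (i + k) *v r k) = 0" if "i \<le> n" for i
    proof -
      have "- of_nat (Suc i) *s (\<Sum>k\<le>n. mult_alpha \<mu> (i + k) *v r k) = 0"
        using sum_pearson_op [OF rec rsupp, of "Suc i"] ker [rule_format, of "Suc i"] that
        unfolding op_r by (simp only: diff_Suc_1 Suc_le_mono)
      then show ?thesis
        by (simp add: vec.scale_eq_0_iff del: of_nat_Suc)
    qed
    then have "r = (\<lambda>_. 0)"
      using R rsupp unfolding nondegenerate_def by blast
    then show "s = (\<lambda>_. 0)"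
      unfolding op_r [symmetric] by (simp add: pearson_op_def fun_eq_iff)
  qed
qed

text \<open>By the product rule D(v\<alpha>) = v(\<Psi> + \<alpha>'), and \<alpha>' = \<alpha>1 + 2
  \<alpha>2 x accounts for both shifts. On moments, the recurrences at n, n + 1, n + 2 are added
  with weights \<alpha>0, \<alpha>1, \<alpha>2.\<close>

lemma pearson_rec_mult_alpha:
  assumes "pearson_rec \<psi>0 \<psi>1 \<mu>"
  shows "pearson_rec (\<psi>0 + mat \<alpha>1) (\<psi>1 + mat (2 * \<alpha>2)) (mult_alpha \<mu>)"
proof -
  have lin: "(a0*p1 + a1*p2 + a2*p3) + (n + 2)*a2*(a0*m1 + a1*m2 + a2*m3)
        + (a0*q0 + a1*q1 + a2*q2) + (n + 1)*a1*(a0*m0 + a1*m1 + a2*m2)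
        + n*a0*(a0*z + a1*m0 + a2*m1) = 0"
    if "p1 + n*a2*m1 + q0 + n*a1*m0 + n*a0*z = 0"
      "p2 + (n + 1)*a2*m2 + q1 + (n + 1)*a1*m1 + (n + 1)*a0*m0 = 0"
      "p3 + (n + 2)*a2*m3 + q2 + (n + 2)*a1*m2 + (n + 2)*a0*m1 = 0"
    for a0 a1 a2 p1 p2 p3 q0 q1 q2 m0 m1 m2 m3 n z :: complex
  proof -
    have "(a0*p1 + a1*p2 + a2*p3) + (n + 2)*a2*(a0*m1 + a1*m2 + a2*m3)
        + (a0*q0 + a1*q1 + a2*q2) + (n + 1)*a1*(a0*m0 + a1*m1 + a2*m2)
        + n*a0*(a0*z + a1*m0 + a2*m1)
      = a0*(p1 + n*a2*m1 + q0 + n*a1*m0 + n*a0*z)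
        + a1*(p2 + (n + 1)*a2*m2 + q1 + (n + 1)*a1*m1 + (n + 1)*a0*m0)
        + a2*(p3 + (n + 2)*a2*m3 + q2 + (n + 2)*a1*m2 + (n + 2)*a0*m1)"
      by (simp add: algebra_simps)
    then show ?thesis by (simp only: that mult_zero_right add_0)
  qed
  show ?thesis
    unfolding pearson_rec_iff_vec
  proof (intro allI)
    fix n x
    note h = assms [unfolded pearson_rec_iff_vec, rule_format, of _ x, unfolded cvec_eq_iff, rule_format]
    have h0: "(\<mu> (Suc n) *v (\<psi>1 *v x)) $ s + of_nat n * \<alpha>2 * (\<mu> (Suc n) *v x) $ s
        + (\<mu> n *v (\<psi>0 *v x)) $ s + of_nat n * \<alpha>1 * (\<mu> n *v x) $ s
        + of_nat n * \<alpha>0 * (\<mu> (n - 1) *v x) $ s = 0" for s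
      using h [of n s] by simp
    have h1: "(\<mu> (Suc (Suc n)) *v (\<psi>1 *v x)) $ s + (of_nat n + 1) * \<alpha>2 * (\<mu> (Suc (Suc n)) *v x) $ s
        + (\<mu> (Suc n) *v (\<psi>0 *v x)) $ s + (of_nat n + 1) * \<alpha>1 * (\<mu> (Suc n) *v x) $ s
        + (of_nat n + 1) * \<alpha>0 * (\<mu> n *v x) $ s = 0" for s
      using h [of "Suc n" s] by (simp add: add.commute [of 1])
    have h2: "(\<mu> (Suc (Suc (Suc n))) *v (\<psi>1 *v x)) $ s + (of_nat n + 2) * \<alpha>2 * (\<mu> (Suc (Suc (Suc n))) *v x) $ s
        + (\<mu> (Suc (Suc n)) *v (\<psi>0 *v x)) $ s + (of_nat n + 2) * \<alpha>1 * (\<mu> (Suc (Suc n)) *v x) $ s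
        + (of_nat n + 2) * \<alpha>0 * (\<mu> (Suc n) *v x) $ s = 0" for s
      using h [of "Suc (Suc n)" s] by (simp add: add.commute [of _ 2])
    \<comment> \<open>At n = 0 the bracket is not the value of \<open>mult_alpha\<close>, but both
      sides carry the factor zero.\<close>
    have z: "of_nat n * \<alpha>0 * (mult_alpha \<mu> (n - 1) *v x) $ s = of_nat n * \<alpha>0 * (\<alpha>0 * (\<mu> (n - 1) *v x) $ s
        + \<alpha>1 * (\<mu> n *v x) $ s + \<alpha>2 * (\<mu> (Suc n) *v x) $ s)" for s
      by (cases n) (simp_all add: mult_alpha_vec)
    show "mult_alpha \<mu> (Suc n) *v ((\<psi>1 + mat (2 * \<alpha>2)) *v x) + (of_nat n * \<alpha>2) *s (mult_alpha \<mu> (Suc n) *v x)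
        + mult_alpha \<mu> n *v ((\<psi>0 + mat \<alpha>1) *v x) + (of_nat n * \<alpha>1) *s (mult_alpha \<mu> n *v x)
        + (of_nat n * \<alpha>0) *s (mult_alpha \<mu> (n - 1) *v x) = 0"
      unfolding cvec_eq_iff
    proof
      fix s
      show "(mult_alpha \<mu> (Suc n) *v ((\<psi>1 + mat (2 * \<alpha>2)) *v x) + (of_nat n * \<alpha>2) *s (mult_alpha \<mu> (Suc n) *v x)
          + mult_alpha \<mu> n *v ((\<psi>0 + mat \<alpha>1) *v x) + (of_nat n * \<alpha>1) *s (mult_alpha \<mu> n *v x)
          + (of_nat n * \<alpha>0) *s (mult_alpha \<mu> (n - 1) *v x)) $ s = 0 $ s"
        using lin [OF h0 h1 h2] unfolding z [symmetric]
        by (simp add: matrix_vector_mult_add_rdistrib mat_vector_mult matrix_vector_right_distrib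
            vector_scalar_commute mult_alpha_vec) (simp add: algebra_simps)
    qed
  qed
qed

text \<open>With A = - N_0 M_0^-1 the recurrence at 0 reads \<mu>_1 = \<mu>_0 A. The factor M_0^-1
  M_1 = I + \<alpha>2 M_0^-1 is such that the recurrence at 1, multiplied on the right by M_0^-1,
  eliminates \<mu>_2.\<close>

lemma mult_alpha_0:
  assumes rec: "pearson_rec \<psi>0 \<psi>1 \<mu>" and M0: "invertible (coeffM \<psi>1 0)"
  shows "mult_alpha \<mu> 0 ** (matrix_inv (coeffM \<psi>1 0) ** coeffM \<psi>1 1)
    = \<mu> 0 ** quad_at \<alpha>0 \<alpha>1 \<alpha>2 (- (coeffN \<psi>0 0 ** matrix_inv (coeffM \<psi>1 0)))"
proof -
  define B where "B = matrix_inv \<psi>1"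
  define A where "A = - (\<psi>0 ** B)"
  have \<psi>1: "coeffM \<psi>1 0 = \<psi>1" and \<psi>0: "coeffN \<psi>0 0 = \<psi>0"
    by (simp_all add: coeffM_def coeffN_def)
  have B: "\<psi>1 *v (B *v x) = x" "B *v (\<psi>1 *v x) = x" for x
    using M0 by (simp_all add: matrix_vector_mul_assoc B_def \<psi>1 invertible_matrix_inv)
  have A: "A *v x = - (\<psi>0 *v (B *v x))" for x
    unfolding A_def matrix_vector_mul_assoc
    by (metis add.right_inverse add_eq_0_iff matrix_vector_mult_0 matrix_vector_mult_add_rdistrib)
  note h = rec [unfolded pearson_rec_iff_vec, rule_format]
  have mu1: "\<mu> 1 *v x = \<mu> 0 *v (A *v x)" for x
    using h [of 0 "B *v x"] by (simp add: A B matrix_vector_mult_minus add_eq_0_iff2)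
  have "mult_alpha \<mu> 0 *v (B *v (coeffM \<psi>1 1 *v y)) = \<mu> 0 *v (quad_at \<alpha>0 \<alpha>1 \<alpha>2 A *v y)" for y
  proof -
    have Bz: "B *v (coeffM \<psi>1 1 *v y) = y + \<alpha>2 *s (B *v y)"
      by (simp add: coeffM_vec matrix_vector_right_distrib vector_scalar_commute B)
    have "mult_alpha \<mu> 0 *v (y + \<alpha>2 *s (B *v y)) = \<alpha>0 *s (\<mu> 0 *v y) + \<alpha>1 *s (\<mu> 1 *v y) + \<alpha>2 *s (\<mu> 1 *v (A *v y))"
    proof -
      have mu2: "\<mu> 2 *v y + \<alpha>0 *s (\<mu> 0 *v (B *v y)) + \<alpha>1 *s (\<mu> 1 *v (B *v y)) + \<alpha>2 *s (\<mu> 2 *v (B *v y))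
          = \<mu> 1 *v (A *v y)"
        using h [of 1 "B *v y"]
        by (simp add: A B matrix_vector_mult_minus eq_neg_iff_add_eq_0 add_ac numeral_2_eq_2)
      show ?thesis
        unfolding mu2 [symmetric]
        by (simp add: mult_alpha_vec matrix_vector_right_distrib vector_scalar_commute
            vec.scale_right_distrib add_ac numeral_2_eq_2)
    qed
    then show ?thesis
      unfolding Bz mu1 by (simp add: quad_at_def matrix_vector_mult_add_rdistrib mat_vector_mult
          matrix_vector_right_distrib vector_scalar_commute flip: matrix_vector_mul_assoc)
  qed
  then show ?thesis
    unfolding \<psi>1 \<psi>0 matrix_eq B_def [symmetric] A_def [symmetric]
    by (simp flip: matrix_vector_mul_assoc)
qed

lemma invertible_mult_alpha_0:
  assumes rec: "pearson_rec \<psi>0 \<psi>1 \<mu>" and M: "\<And>n. invertible (coeffM \<psi>1 n)"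
  shows "invertible (mult_alpha \<mu> 0) \<longleftrightarrow>
    invertible (\<mu> 0) \<and> invertible (quad_at \<alpha>0 \<alpha>1 \<alpha>2 (- (coeffN \<psi>0 0 ** matrix_inv (coeffM \<psi>1 0))))"
proof -
  have "invertible (matrix_inv (coeffM \<psi>1 0))"
    using invertible_matrix_inv [OF M [of 0]] by (auto simp: invertible_def)
  then have "invertible (mult_alpha \<mu> 0) \<longleftrightarrow> invertible (mult_alpha \<mu> 0 ** (matrix_inv (coeffM \<psi>1 0) ** coeffM \<psi>1 1))"
    using M by (simp add: invertible_mult_iff)
  then show ?thesis
    unfolding mult_alpha_0 [OF rec M] invertible_mult_iff .
qed

text \<open>All degrees up to n are treated together because \<open>nondegenerate_Suc\<close> needs
  \<mu>_0 invertible, which is the case k = 0. Passing to u\<alpha> changes \<psi>0 and \<psi>1, so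
  the induction generalises them.\<close>

lemma nondegenerate_iff_mult_alpha:
  assumes "pearson_rec \<psi>0 \<psi>1 \<mu>" "\<And>n. invertible (coeffM \<psi>1 n)"
  shows "(\<forall>k\<le>n. nondegenerate \<mu> k) \<longleftrightarrow> (\<forall>k\<le>n. invertible ((mult_alpha ^^ k) \<mu> 0))"
  using assms
proof (induction n arbitrary: \<mu> \<psi>0 \<psi>1)
  case 0
  then show ?case by (simp add: nondegenerate_0)
next
  case (Suc n)
  have all_Suc: "(\<forall>k\<le>Suc n. P k) \<longleftrightarrow> P 0 \<and> (\<forall>k\<le>n. P (Suc k))" for P
    by (metis Suc_le_mono le_SucE less_eq_nat.simps(1) not0_implies_Suc)
  have "(\<forall>k\<le>n. nondegenerate (mult_alpha \<mu>) k) \<longleftrightarrow> (\<forall>k\<le>n. invertible ((mult_alpha ^^ k) (mult_alpha \<mu>) 0))"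
    using Suc.prems
    by (intro Suc.IH [of "\<psi>0 + mat \<alpha>1" "\<psi>1 + mat (2 * \<alpha>2)"] pearson_rec_mult_alpha)
      (simp_all add: coeffM_shift)
  then show ?case
    unfolding all_Suc using nondegenerate_Suc [OF Suc.prems(1) Suc.prems(2)]
    by (auto simp: nondegenerate_0 funpow_Suc_right simp del: funpow.simps)
qed

lemma pearson_rec_funpow:
  assumes "pearson_rec \<psi>0 \<psi>1 \<mu>"
  shows "pearson_rec (coeffN \<psi>0 k) (coeffM \<psi>1 (2 * k)) ((mult_alpha ^^ k) \<mu>)"
proof (induction k)
  case 0
  then show ?case using assms by (simp add: coeffN_def coeffM_def)
next
  case (Suc k)
  have "coeffN \<psi>0 (Suc k) = coeffN \<psi>0 k + mat \<alpha>1" "coeffM \<psi>1 (2 * Suc k) = coeffM \<psi>1 (2 * k) + mat (2 * \<alpha>2)"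
    by (simp_all add: coeffN_def coeffM_def cvec_eq_iff Finite_Cartesian_Product.mat_def algebra_simps)
  then show ?case
    using pearson_rec_mult_alpha [OF Suc] by simp
qed

lemma nondegenerate_iff:
  assumes rec: "pearson_rec \<psi>0 \<psi>1 \<mu>" and M: "\<And>n. invertible (coeffM \<psi>1 n)"
  shows "(\<forall>n. nondegenerate \<mu> n) \<longleftrightarrow> invertible (\<mu> 0) \<and>
    (\<forall>n. invertible (quad_at \<alpha>0 \<alpha>1 \<alpha>2 (- (coeffN \<psi>0 n ** matrix_inv (coeffM \<psi>1 (2 * n))))))"
    (is "_ \<longleftrightarrow> _ \<and> (\<forall>n. ?Q n)")
proof -
  \<comment> \<open>The k-th iterate has N_k and M_2k as its coefficients at index 0; this is the
    source of the argument - N_k M_2k^-1.\<close>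
  have step: "invertible ((mult_alpha ^^ Suc k) \<mu> 0) \<longleftrightarrow> invertible ((mult_alpha ^^ k) \<mu> 0) \<and> ?Q k" for k
  proof -
    have "coeffN (coeffN \<psi>0 k) 0 = coeffN \<psi>0 k" "coeffM (coeffM \<psi>1 (2 * k)) n = coeffM \<psi>1 (2 * k + n)" for n
      by (simp_all add: coeffN_def coeffM_def cvec_eq_iff Finite_Cartesian_Product.mat_def algebra_simps)
    then show ?thesis
      using invertible_mult_alpha_0 [OF pearson_rec_funpow [OF rec, of k]] M by simp
  qed
  have "(\<forall>n. nondegenerate \<mu> n) \<longleftrightarrow> (\<forall>k. invertible ((mult_alpha ^^ k) \<mu> 0))"
    using nondegenerate_iff_mult_alpha [OF rec M] by (metis order_refl)
  also have "\<dots> \<longleftrightarrow> invertible (\<mu> 0) \<and> (\<forall>n. ?Q n)"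
  proof safe
    assume L: "\<forall>k. invertible ((mult_alpha ^^ k) \<mu> 0)"
    show "invertible (\<mu> 0)" using L [rule_format, of 0] by simp
    show "?Q n" for n using L step [of n] by metis
  next
    fix k assume Q: "invertible (\<mu> 0)" "\<forall>n. ?Q n"
    show "invertible ((mult_alpha ^^ k) \<mu> 0)"
    proof (induction k)
      case (Suc k)
      then show ?case unfolding step using Q(2) by blast
    qed (simp add: Q)
  qed
  finally show ?thesis .
qed

section \<open>From the functional equation to the recurrence, and its solutions\<close>

lemma pearson_solution_iff:
  fixes u :: "'m::finite mfunctional"
  shows "pearson_solution \<alpha>0 \<alpha>1 \<alpha>2 \<psi>0 \<psi>1 u \<longleftrightarrow> left_linear u \<and> pearson_rec \<psi>0 \<psi>1 (moment u)"
proof (cases "left_linear u")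
  case True
  let ?Q = "[:mat \<alpha>0, mat \<alpha>1, mat \<alpha>2:] :: 'm cmat poly"
  let ?L = "deriv_fun (fun_mult_poly u ?Q)" and ?R = "fun_mult_poly u [:\<psi>0, \<psi>1:]"
  have "degree ?Q \<le> 2" "degree [:\<psi>0, \<psi>1:] \<le> 1"
    by (simp_all add: degree_pCons_eq_if)
  have L: "moment ?L n = - (mat (of_nat n) ** (moment u (n - 1) ** mat \<alpha>0 + moment u (n - 1 + 1) ** mat \<alpha>1
      + moment u (n - 1 + 2) ** mat \<alpha>2))" for n
    using moment_fun_mult_poly [OF \<open>degree ?Q \<le> 2\<close>] True
    by (simp add: moment_deriv_fun left_linear_fun_mult_poly eval_nat_numeral)
  have R: "moment ?R n = moment u n ** \<psi>0 + moment u (Suc n) ** \<psi>1" for n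
    using moment_fun_mult_poly [OF \<open>degree [:\<psi>0, \<psi>1:] \<le> 1\<close>] by simp
  have "?L = ?R \<longleftrightarrow> (\<forall>n. moment ?L n = moment ?R n)"
    using left_linear_eqI left_linear_deriv_fun left_linear_fun_mult_poly True by metis
  also have "\<dots> \<longleftrightarrow> pearson_rec \<psi>0 \<psi>1 (moment u)"
    unfolding pearson_rec_def
  proof (rule all_cong1)
    fix n
    \<comment> \<open>For n > 0 the indices \<open>n - 1 + 1\<close> and \<open>n - 1 + 2\<close>
      are n and n + 1; for n = 0 the derivative term vanishes as a whole.\<close>
    have "moment ?R n - moment ?L n = moment u (Suc n) ** coeffM \<psi>1 n + moment u n ** coeffN \<psi>0 n
        + mat (of_nat n * \<alpha>0) ** moment u (n - 1)"
      unfolding L R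
      by (cases n) (simp_all add: coeffM_def coeffN_def matrix_add_ldistrib cvec_eq_iff mat_mul_component
          mul_mat_component algebra_simps)
    then show "moment ?L n = moment ?R n \<longleftrightarrow> moment u (Suc n) ** coeffM \<psi>1 n + moment u n ** coeffN \<psi>0 n
        + mat (of_nat n * \<alpha>0) ** moment u (n - 1) = 0"
      by (metis eq_iff_diff_eq_0)
  qed
  finally show ?thesis
    using True by (simp add: pearson_solution_def)
qed (simp add: pearson_solution_def)

text \<open>Cancelling M_k determines \<mu>_(k+1) from up to two earlier moments, hence the strong
  induction.\<close>

lemma pearson_rec_unique:
  assumes "\<And>n. invertible (coeffM \<psi>1 n)" "pearson_rec \<psi>0 \<psi>1 \<mu>" "pearson_rec \<psi>0 \<psi>1 \<nu>" "\<mu> 0 = \<nu> 0"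
  shows "\<mu> n = \<nu> n"
proof (induction n rule: less_induct)
  case (less n)
  show ?case
  proof (cases n)
    case (Suc k)
    have "\<mu> (Suc k) ** coeffM \<psi>1 k = \<nu> (Suc k) ** coeffM \<psi>1 k"
      using assms(2,3) less Suc unfolding pearson_rec_def
      by (metis add_right_cancel diff_le_self le_imp_less_Suc lessI)
    then have "\<mu> (Suc k) ** (coeffM \<psi>1 k ** matrix_inv (coeffM \<psi>1 k)) = \<nu> (Suc k) ** (coeffM \<psi>1 k ** matrix_inv (coeffM \<psi>1 k))"
      by (simp add: matrix_mul_assoc)
    then show ?thesis using assms(1) Suc by (simp add: invertible_matrix_inv)
  qed (simp add: assms)
qed

text \<open>The recurrence solved for \<mu>_(n+1). At n = 0 the value at \<open>n - 1\<close> has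
  factor 0, so one initial value is enough.\<close>

fun pearson_moments :: "'m::finite cmat \<Rightarrow> 'm cmat \<Rightarrow> 'm cmat \<Rightarrow> nat \<Rightarrow> 'm cmat" where
  "pearson_moments \<psi>0 \<psi>1 A 0 = A"
| "pearson_moments \<psi>0 \<psi>1 A (Suc n) =
     - ((pearson_moments \<psi>0 \<psi>1 A n ** coeffN \<psi>0 n + mat (of_nat n * \<alpha>0) ** pearson_moments \<psi>0 \<psi>1 A (n - 1))
        ** matrix_inv (coeffM \<psi>1 n))"

lemma pearson_rec_exists:
  fixes \<psi>0 \<psi>1 A :: "'m::finite cmat"
  assumes "\<And>n. invertible (coeffM \<psi>1 n)"
  shows "pearson_rec \<psi>0 \<psi>1 (pearson_moments \<psi>0 \<psi>1 A)"
proof -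
  have "- (X ** matrix_inv (coeffM \<psi>1 n)) ** coeffM \<psi>1 n = - X" for X :: "'m cmat" and n
  proof -
    have "- (X ** matrix_inv (coeffM \<psi>1 n)) ** coeffM \<psi>1 n = - (X ** (matrix_inv (coeffM \<psi>1 n) ** coeffM \<psi>1 n))"
      unfolding matrix_mul_assoc by (simp add: cvec_eq_iff matrix_matrix_mult_def sum_negf)
    then show ?thesis using assms by (simp add: invertible_matrix_inv)
  qed
  then show ?thesis by (simp add: pearson_rec_def)
qed

text \<open>The coefficients of the recurrence act from the right or are scalar, so a left factor
  passes through.\<close>

lemma pearson_rec_lmult:
  assumes "pearson_rec \<psi>0 \<psi>1 \<mu>"
  shows "pearson_rec \<psi>0 \<psi>1 (\<lambda>n. A ** \<mu> n)"
proof -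
  have "A ** \<mu> (Suc n) ** coeffM \<psi>1 n + A ** \<mu> n ** coeffN \<psi>0 n + mat (of_nat n * \<alpha>0) ** (A ** \<mu> (n - 1))
      = A ** (\<mu> (Suc n) ** coeffM \<psi>1 n + \<mu> n ** coeffN \<psi>0 n + mat (of_nat n * \<alpha>0) ** \<mu> (n - 1))" for n
    by (simp only: matrix_add_ldistrib mat_mul_left_commute matrix_mul_assoc [of A, symmetric])
  then show ?thesis
    using assms by (simp add: pearson_rec_def)
qed

end

theorem theorem4p1:
  fixes \<alpha>0 \<alpha>1 \<alpha>2 :: complex
    and \<psi>0 \<psi>1 :: "complex^'m^'m"
    and N M :: "nat \<Rightarrow> complex^'m^'m"
  assumes alpha_nonzero: "[:\<alpha>0, \<alpha>1, \<alpha>2:] \<noteq> 0"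
    and N_def: "\<And>n. N n = \<psi>0 + mat (of_nat n * \<alpha>1)"
    and M_def: "\<And>n. M n = \<psi>1 + mat (of_nat n * \<alpha>2)"
  shows
    "((\<exists>u. pearson_solution \<alpha>0 \<alpha>1 \<alpha>2 \<psi>0 \<psi>1 u \<and> quasi_definite u) \<longleftrightarrow>
        (\<forall>n. invertible (M n)) \<and>
        (\<forall>n. invertible (quad_at \<alpha>0 \<alpha>1 \<alpha>2 (- (N n ** matrix_inv (M (2 * n)))))))
     \<and>
     ((\<forall>n. invertible (M n)) \<and>
      (\<forall>n. invertible (quad_at \<alpha>0 \<alpha>1 \<alpha>2 (- (N n ** matrix_inv (M (2 * n)))))) \<longrightarrow>
        (\<forall>A. \<exists>!u. pearson_solution \<alpha>0 \<alpha>1 \<alpha>2 \<psi>0 \<psi>1 u \<and> moment u 0 = A) \<and>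
        (\<exists>u1. pearson_solution \<alpha>0 \<alpha>1 \<alpha>2 \<psi>0 \<psi>1 u1 \<and> moment u1 0 = mat 1 \<and>
              (\<forall>u. pearson_solution \<alpha>0 \<alpha>1 \<alpha>2 \<psi>0 \<psi>1 u \<longleftrightarrow> u = lmult_fun (moment u 0) u1)) \<and>
        (\<forall>u. pearson_solution \<alpha>0 \<alpha>1 \<alpha>2 \<psi>0 \<psi>1 u \<longrightarrow>
              (quasi_definite u \<longleftrightarrow> invertible (moment u 0))))"
proof -
  let ?sol = "pearson_solution \<alpha>0 \<alpha>1 \<alpha>2 \<psi>0 \<psi>1"
  let ?Q = "\<forall>n. invertible (quad_at \<alpha>0 \<alpha>1 \<alpha>2 (- (N n ** matrix_inv (M (2 * n)))))"
  \<comment> \<open>Outside the context each constant takes only the \<alpha>'s that it uses, as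
    leading arguments.\<close>
  have NM: "N = coeffN \<alpha>1 \<psi>0" "M = coeffM \<alpha>2 \<psi>1"
    by (simp_all add: fun_eq_iff coeffN_def coeffM_def N_def M_def)
  have qd: "quasi_definite u \<longleftrightarrow> invertible (moment u 0) \<and> ?Q"
    if "\<forall>n. invertible (M n)" "?sol u" for u
    using that nondegenerate_iff [of \<alpha>0 \<alpha>1 \<alpha>2 \<psi>0 \<psi>1 "moment u"]
    unfolding quasi_definite_iff NM pearson_solution_iff by blast
  have M_inv: "invertible (M n)" if "?sol u" "quasi_definite u" for u n
    using that coeffM_invertible [OF alpha_nonzero]
    unfolding quasi_definite_iff NM pearson_solution_iff by blast
  have exists: "\<exists>u. ?sol u \<and> moment u 0 = A" if M: "\<forall>n. invertible (M n)" for A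
  proof (intro exI conjI)
    let ?u = "functional_of_moments (pearson_moments \<alpha>0 \<alpha>1 \<alpha>2 \<psi>0 \<psi>1 A)"
    show "?sol ?u"
      using pearson_rec_exists [of \<alpha>2 \<psi>1 \<alpha>0 \<alpha>1 \<psi>0 A] M unfolding NM pearson_solution_iff
      by (simp add: left_linear_functional_of_moments moment_functional_of_moments [abs_def])
    show "moment ?u 0 = A"
      by (simp add: moment_functional_of_moments)
  qed
  have unique: "u = v"
    if M: "\<forall>n. invertible (M n)" and "?sol u" "?sol v" "moment u 0 = moment v 0" for u v
    using that pearson_rec_unique [of \<alpha>2 \<psi>1 \<alpha>0 \<alpha>1 \<psi>0 "moment u" "moment v"]
    unfolding NM pearson_solution_iff by (blast intro: left_linear_eqI)
  have lmult: "?sol (lmult_fun A u)" if "?sol u" for A u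
  proof -
    have "moment (lmult_fun A u) = (\<lambda>n. A ** moment u n)"
      using that by (simp add: fun_eq_iff moment_lmult_fun pearson_solution_iff)
    then show ?thesis
      using that by (simp add: pearson_solution_iff left_linear_lmult_fun pearson_rec_lmult)
  qed
  have basic: "\<exists>u1. ?sol u1 \<and> moment u1 0 = mat 1 \<and> (\<forall>u. ?sol u \<longleftrightarrow> u = lmult_fun (moment u 0) u1)"
    if M: "\<forall>n. invertible (M n)"
  proof -
    obtain u1 where u1: "?sol u1" "moment u1 0 = mat 1"
      using exists [OF M] by blast
    then have "moment (lmult_fun A u1) 0 = A" for A
      by (simp add: pearson_solution_iff moment_lmult_fun)
    \<comment> \<open>\<open>lmult_fun (moment u 0) u1\<close> is a solution with the zeroth moment
      of \<open>u\<close>, so uniqueness identifies the two.\<close>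
    then have "?sol u \<longleftrightarrow> u = lmult_fun (moment u 0) u1" for u
      using unique [OF M _ lmult [OF u1(1)]] lmult [OF u1(1)] by metis
    with u1 show ?thesis by blast
  qed
  have ex1: "\<exists>!u. ?sol u \<and> moment u 0 = A" if "\<forall>n. invertible (M n)" for A
    using exists [OF that] unique [OF that] by metis
  have "(\<exists>u. ?sol u \<and> quasi_definite u) \<longleftrightarrow> (\<forall>n. invertible (M n)) \<and> ?Q"
  proof
    assume "\<exists>u. ?sol u \<and> quasi_definite u"
    then show "(\<forall>n. invertible (M n)) \<and> ?Q"
      using M_inv qd by blast
  next
    assume R: "(\<forall>n. invertible (M n)) \<and> ?Q"
    then obtain u where "?sol u" "moment u 0 = mat 1"
      using exists by blast
    moreover have "invertible (mat 1 :: 'm cmat)"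
      by (simp add: invertible_det_nz)
    ultimately show "\<exists>u. ?sol u \<and> quasi_definite u"
      using R qd by metis
  qed
  then show ?thesis
  proof (intro conjI impI allI)
    fix A
    assume "(\<forall>n. invertible (M n)) \<and> ?Q"
    then show "\<exists>!u. ?sol u \<and> moment u 0 = A" by (intro ex1) (rule conjunct1)
  next
    assume "(\<forall>n. invertible (M n)) \<and> ?Q"
    then show "\<exists>u1. ?sol u1 \<and> moment u1 0 = mat 1 \<and> (\<forall>u. ?sol u \<longleftrightarrow> u = lmult_fun (moment u 0) u1)"
      by (intro basic) (rule conjunct1)
  next
    fix u
    assume "(\<forall>n. invertible (M n)) \<and> ?Q" "?sol u"
    then show "quasi_definite u \<longleftrightarrow> invertible (moment u 0)" using qd [of u] by simp
  qed
qed

end
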